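(* Let $(D^{\le0},D^{\ge0})$ be a bounded t-structure on a triangulated category $\mathcal{T}$ with core $\mathcal{A}=D^{\le0}\cap D^{\ge0}$. For $i\in\mathbb{Z}$ let $\Pi_i=\mathcal{A}[i]=D^{\le-i}\cap D^{\ge-i}$. Then $(\mathbb{Z},\{\Pi_i\}_{i\in\mathbb{Z}})$ is a t-stability on $\mathcal{T}$ (with the natural order on $\mathbb{Z}$).
   Context: A t-structure on $\mathcal{T}$ is a pair $(D^{\le0},D^{\ge0})$ of strictly full subcategories with $D^{\le0}\subset D^{\le0}[-1]$, $D^{\ge0}\supset D^{\ge0}[-1]$; $\mathrm{Hom}^0(D^{\le0},D^{\ge0}[-1])=0$; and every $X\in\mathcal{T}$ fits into a distinguished triangle $X_{\le0}\to X\to X_{\ge1}\to X_{\le0}[1]$ with $X_{\le0}\in D^{\le0}$, $X_{\ge1}\in D^{\ge0}[-1]$. Notation: $D^{\le n}=D^{\le0}[-n]$, $D^{\ge n}=D^{\ge0}[-n]$. It is bounded if for every $X$ there are $m,n\in\mathbb{Z}$ with $X\in D^{\ge m}\cap D^{\le n}$. Write $\mathrm{Hom}^i(X,Y)=\mathrm{Hom}_{\mathcal{T}}(X,Y[i])$; $\mathrm{Hom}^{\le 0}(\mathcal{X},\mathcal{Y})=0$ means $\mathrm{Hom}^i(X,Y)=0$ for all $i\le 0$, $X\in\mathcal{X}$, $Y\in\mathcal{Y}$. A subcategory $\mathcal{X}$ is extension-closed if for every distinguished triangle $A\to B\to C\to A[1]$ with $A,C\in\mathcal{X}$ also $B\in\mathcal{X}$.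 A t-stability on $\mathcal{T}$ is a pair $(\Phi,\{\Pi_\varphi\}_{\varphi\in\Phi})$, where $\Phi$ is a linearly ordered set and each $\Pi_\varphi\subset\mathcal{T}$ is a nonempty, strictly full (full and closed under isomorphisms), extension-closed subcategory, such that: (1) there is an automorphism $\tau$ of the ordered set $\Phi$ with $\Pi_\varphi[1]=\Pi_{\tau(\varphi)}$ and $\tau(\varphi)\ge\varphi$ for all $\varphi$; (2) $\mathrm{Hom}^{\le 0}(\Pi_\psi,\Pi_\varphi)=0$ whenever $\psi>\varphi$; (3) every nonzero $X\in\mathcal{T}$ has a finite system of distinguished triangles $F^{i+1}X\to F^iX\to X_{\varphi_i}\to F^{i+1}X[1]$, $0\le i\le n$, with $F^0X=X$, $F^{n+1}X=0$, $0\ne X_{\varphi_i}\in\Pi_{\varphi_i}$ and $\varphi_0<\dots<\varphi_n$. *)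

theory Defs
  imports "HOL-Algebra.Group"
begin

section \<open>Categories\<close>

record ('o, 'm) cat =
  Obj :: "'o set"
  Arr :: "'m set"
  Dom :: "'m \<Rightarrow> 'o"
  Cod :: "'m \<Rightarrow> 'o"
  Ident :: "'o \<Rightarrow> 'm"
  Comp :: "'m \<Rightarrow> 'm \<Rightarrow> 'm" (infixl "\<cdot>\<index>" 70)

definition Hom :: "('o, 'm, 'z) cat_scheme \<Rightarrow> 'o \<Rightarrow> 'o \<Rightarrow> 'm set" where
  "Hom C X Y = {f \<in> Arr C. Dom C f = X \<and> Cod C f = Y}"

locale cat =
  fixes C (structure)
  assumes Dom_Obj: "f \<in> Arr C \<Longrightarrow> Dom C f \<in> Obj C"
    and Cod_Obj: "f \<in> Arr C \<Longrightarrow> Cod C f \<in> Obj C"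
    and Ident_Hom: "X \<in> Obj C \<Longrightarrow> Ident C X \<in> Hom C X X"
    and Comp_Hom: "\<lbrakk>f \<in> Hom C X Y; g \<in> Hom C Y Z\<rbrakk> \<Longrightarrow> g \<cdot> f \<in> Hom C X Z"
    and Comp_Ident: "f \<in> Hom C X Y \<Longrightarrow> f \<cdot> Ident C X = f"
    and Ident_Comp: "f \<in> Hom C X Y \<Longrightarrow> Ident C Y \<cdot> f = f"
    and Comp_assoc: "\<lbrakk>f \<in> Hom C X Y; g \<in> Hom C Y Z; h \<in> Hom C Z W\<rbrakk>
          \<Longrightarrow> (h \<cdot> g) \<cdot> f = h \<cdot> (g \<cdot> f)"

definition is_iso :: "('o, 'm, 'z) cat_scheme \<Rightarrow> 'o \<Rightarrow> 'o \<Rightarrow> 'm \<Rightarrow> bool" where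
  "is_iso C X Y f \<longleftrightarrow> f \<in> Hom C X Y \<and>
     (\<exists>g \<in> Hom C Y X. g \<cdot>\<^bsub>C\<^esub> f = Ident C X \<and> f \<cdot>\<^bsub>C\<^esub> g = Ident C Y)"

definition isomorphic :: "('o, 'm, 'z) cat_scheme \<Rightarrow> 'o \<Rightarrow> 'o \<Rightarrow> bool" where
  "isomorphic C X Y \<longleftrightarrow> (\<exists>f. is_iso C X Y f)"

definition zero_object :: "('o, 'm, 'z) cat_scheme \<Rightarrow> 'o \<Rightarrow> bool" where
  "zero_object C Z \<longleftrightarrow> Z \<in> Obj C \<and>
     (\<forall>X \<in> Obj C. (\<exists>!f. f \<in> Hom C X Z) \<and> (\<exists>!f. f \<in> Hom C Z X))"


section \<open>Additive categories\<close>

text \<open>\<open>Zero C X Y\<close> is the zero morphism from \<open>X\<close> to \<open>Y\<close>.\<close>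

record ('o, 'm) add_cat = "('o, 'm) cat" +
  Add :: "'m \<Rightarrow> 'm \<Rightarrow> 'm"
  Zero :: "'o \<Rightarrow> 'o \<Rightarrow> 'm"

definition Hom_group :: "('o, 'm, 'z) add_cat_scheme \<Rightarrow> 'o \<Rightarrow> 'o \<Rightarrow> 'm monoid" where
  "Hom_group C X Y = \<lparr>carrier = Hom C X Y, mult = Add C, one = Zero C X Y\<rparr>"

locale additive_cat = cat C for C :: "('o, 'm, 'z) add_cat_scheme" (structure) +
  assumes Hom_comm_group: "\<lbrakk>X \<in> Obj C; Y \<in> Obj C\<rbrakk> \<Longrightarrow> comm_group (Hom_group C X Y)"
    and Comp_Add_left: "\<lbrakk>f \<in> Hom C X Y; g \<in> Hom C Y Z; g' \<in> Hom C Y Z\<rbrakk>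
          \<Longrightarrow> Add C g g' \<cdot> f = Add C (g \<cdot> f) (g' \<cdot> f)"
    and Comp_Add_right: "\<lbrakk>f \<in> Hom C X Y; f' \<in> Hom C X Y; g \<in> Hom C Y Z\<rbrakk>
          \<Longrightarrow> g \<cdot> Add C f f' = Add C (g \<cdot> f) (g \<cdot> f')"
    and ex_zero_object: "\<exists>Z. zero_object C Z"
    and ex_biproduct: "\<lbrakk>X \<in> Obj C; Y \<in> Obj C\<rbrakk> \<Longrightarrow>
          \<exists>S \<in> Obj C. \<exists>i \<in> Hom C X S. \<exists>j \<in> Hom C Y S. \<exists>p \<in> Hom C S X. \<exists>q \<in> Hom C S Y.
            p \<cdot> i = Ident C X \<and> q \<cdot> j = Ident C Y \<and>
            p \<cdot> j = Zero C Y X \<and> q \<cdot> i = Zero C X Y \<and>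
            Add C (i \<cdot> p) (j \<cdot> q) = Ident C S"


section \<open>Triangulated categories\<close>

text \<open>The translation functor is an automorphism of the category, as in Verdier and
  Gelfand--Manin. \<open>Dist\<close> is the class of distinguished triangles, each given by its
  three morphisms.\<close>

record ('o, 'm) tri_cat = "('o, 'm) add_cat" +
  Sh_obj :: "'o \<Rightarrow> 'o"
  Sh_arr :: "'m \<Rightarrow> 'm"
  Dist :: "('m \<times> 'm \<times> 'm) set"

definition triangle ::
  "('o, 'm, 'z) tri_cat_scheme \<Rightarrow> 'o \<Rightarrow> 'o \<Rightarrow> 'o \<Rightarrow> 'm \<Rightarrow> 'm \<Rightarrow> 'm \<Rightarrow> bool" where
  "triangle C X Y Z f g h \<longleftrightarrow>
     f \<in> Hom C X Y \<and> g \<in> Hom C Y Z \<and> h \<in> Hom C Z (Sh_obj C X)"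

definition distinguished ::
  "('o, 'm, 'z) tri_cat_scheme \<Rightarrow> 'o \<Rightarrow> 'o \<Rightarrow> 'o \<Rightarrow> 'm \<Rightarrow> 'm \<Rightarrow> 'm \<Rightarrow> bool" where
  "distinguished C X Y Z f g h \<longleftrightarrow> triangle C X Y Z f g h \<and> (f, g, h) \<in> Dist C"

locale triangulated_cat = additive_cat C for C :: "('o, 'm, 'z) tri_cat_scheme" (structure) +
  assumes Sh_obj_bij: "bij_betw (Sh_obj C) (Obj C) (Obj C)"
    and Sh_arr_bij: "bij_betw (Sh_arr C) (Arr C) (Arr C)"
    and Sh_arr_Hom: "f \<in> Hom C X Y \<Longrightarrow> Sh_arr C f \<in> Hom C (Sh_obj C X) (Sh_obj C Y)"
    and Sh_arr_Ident: "X \<in> Obj C \<Longrightarrow> Sh_arr C (Ident C X) = Ident C (Sh_obj C X)"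
    and Sh_arr_Comp: "\<lbrakk>f \<in> Hom C X Y; g \<in> Hom C Y Z\<rbrakk>
          \<Longrightarrow> Sh_arr C (g \<cdot> f) = Sh_arr C g \<cdot> Sh_arr C f"
    and Sh_arr_Add: "\<lbrakk>f \<in> Hom C X Y; f' \<in> Hom C X Y\<rbrakk>
          \<Longrightarrow> Sh_arr C (Add C f f') = Add C (Sh_arr C f) (Sh_arr C f')"
    and TR1_ident: "\<lbrakk>X \<in> Obj C; zero_object C Z\<rbrakk>
          \<Longrightarrow> distinguished C X X Z (Ident C X) (Zero C X Z) (Zero C Z (Sh_obj C X))"
    and TR1_iso: "\<lbrakk>distinguished C X Y Z f g h; triangle C X' Y' Z' f' g' h';
          is_iso C X X' a; is_iso C Y Y' b; is_iso C Z Z' c;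
          b \<cdot> f = f' \<cdot> a; c \<cdot> g = g' \<cdot> b; Sh_arr C a \<cdot> h = h' \<cdot> c\<rbrakk>
          \<Longrightarrow> distinguished C X' Y' Z' f' g' h'"
    and TR1_cone: "f \<in> Hom C X Y \<Longrightarrow> \<exists>Z g h. distinguished C X Y Z f g h"
    and TR2: "triangle C X Y Z f g h \<Longrightarrow>
          distinguished C X Y Z f g h \<longleftrightarrow>
          distinguished C Y Z (Sh_obj C X) g h
            (inv\<^bsub>Hom_group C (Sh_obj C X) (Sh_obj C Y)\<^esub> (Sh_arr C f))"
    and TR3: "\<lbrakk>distinguished C X Y Z f g h; distinguished C X' Y' Z' f' g' h';
          a \<in> Hom C X X'; b \<in> Hom C Y Y'; b \<cdot> f = f' \<cdot> a\<rbrakk>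
          \<Longrightarrow> \<exists>c \<in> Hom C Z Z'. c \<cdot> g = g' \<cdot> b \<and> Sh_arr C a \<cdot> h = h' \<cdot> c"
    and TR4: "\<lbrakk>distinguished C X Y Z' f f' f''; distinguished C Y Z X' g g' g'';
          distinguished C X Z Y' (g \<cdot> f) k' k''\<rbrakk>
          \<Longrightarrow> \<exists>u v. distinguished C Z' Y' X' u v (Sh_arr C f' \<cdot> g'') \<and>
                u \<cdot> f' = k' \<cdot> g \<and> k'' \<cdot> u = f'' \<and>
                v \<cdot> k' = g' \<and> g'' \<cdot> v = Sh_arr C f \<cdot> k''"

text \<open>\<open>shift C n X\<close> is $X[n]$.\<close>

definition shift :: "('o, 'm, 'z) tri_cat_scheme \<Rightarrow> int \<Rightarrow> 'o \<Rightarrow> 'o" where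
  "shift C n X =
     (if 0 \<le> n then (Sh_obj C ^^ nat n) X
      else (inv_into (Obj C) (Sh_obj C) ^^ nat (- n)) X)"

text \<open>$\mathrm{Hom}^i(X,Y) = \mathrm{Hom}(X,Y[i])$\<close>

definition Hom_deg :: "('o, 'm, 'z) tri_cat_scheme \<Rightarrow> int \<Rightarrow> 'o \<Rightarrow> 'o \<Rightarrow> 'm set" where
  "Hom_deg C i X Y = Hom C X (shift C i Y)"

text \<open>Full subcategories are represented by their sets of objects.\<close>

definition shift_sub :: "('o, 'm, 'z) tri_cat_scheme \<Rightarrow> 'o set \<Rightarrow> int \<Rightarrow> 'o set" where
  "shift_sub C S n = shift C n ` S"

definition Hom_deg_vanishes ::
  "('o, 'm, 'z) tri_cat_scheme \<Rightarrow> int \<Rightarrow> 'o set \<Rightarrow> 'o set \<Rightarrow> bool" where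
  "Hom_deg_vanishes C i S T \<longleftrightarrow>
     (\<forall>X \<in> S. \<forall>Y \<in> T. Hom_deg C i X Y = {Zero C X (shift C i Y)})"

definition strictly_full :: "('o, 'm, 'z) cat_scheme \<Rightarrow> 'o set \<Rightarrow> bool" where
  "strictly_full C S \<longleftrightarrow> S \<subseteq> Obj C \<and> (\<forall>X \<in> S. \<forall>Y \<in> Obj C. isomorphic C X Y \<longrightarrow> Y \<in> S)"

definition extension_closed :: "('o, 'm, 'z) tri_cat_scheme \<Rightarrow> 'o set \<Rightarrow> bool" where
  "extension_closed C S \<longleftrightarrow>
     (\<forall>X Y Z f g h. distinguished C X Y Z f g h \<and> X \<in> S \<and> Z \<in> S \<longrightarrow> Y \<in> S)"


section \<open>t-structures\<close>

text \<open>In what follows \<open>L\<close> and \<open>R\<close> stand for $D^{\le 0}$ and $D^{\ge 0}$, and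
  \<open>D_le C L n\<close>, \<open>D_ge C R n\<close> for $D^{\le n}$, $D^{\ge n}$.\<close>

definition D_le :: "('o, 'm, 'z) tri_cat_scheme \<Rightarrow> 'o set \<Rightarrow> int \<Rightarrow> 'o set" where
  "D_le C L n = shift_sub C L (- n)"

definition D_ge :: "('o, 'm, 'z) tri_cat_scheme \<Rightarrow> 'o set \<Rightarrow> int \<Rightarrow> 'o set" where
  "D_ge C R n = shift_sub C R (- n)"

definition t_structure :: "('o, 'm, 'z) tri_cat_scheme \<Rightarrow> 'o set \<Rightarrow> 'o set \<Rightarrow> bool" where
  "t_structure C L R \<longleftrightarrow>
     strictly_full C L \<and> strictly_full C R \<and>
     L \<subseteq> D_le C L 1 \<and> D_ge C R 1 \<subseteq> R \<and>
     Hom_deg_vanishes C 0 L (D_ge C R 1) \<and>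
     (\<forall>X \<in> Obj C. \<exists>A \<in> L. \<exists>B \<in> D_ge C R 1. \<exists>f g h. distinguished C A X B f g h)"

definition bounded_t_structure :: "('o, 'm, 'z) tri_cat_scheme \<Rightarrow> 'o set \<Rightarrow> 'o set \<Rightarrow> bool" where
  "bounded_t_structure C L R \<longleftrightarrow> t_structure C L R \<and>
     (\<forall>X \<in> Obj C. \<exists>m n. X \<in> D_ge C R m \<inter> D_le C L n)"

definition core :: "'o set \<Rightarrow> 'o set \<Rightarrow> 'o set" where
  "core L R = L \<inter> R"


section \<open>t-stabilities\<close>

text \<open>The linearly ordered set is a set \<open>\<Phi>\<close> with a reflexive linear order \<open>r\<close> on it,
  \<open>(\<phi>, \<psi>) \<in> r\<close> meaning $\varphi \le \psi$.\<close>

definition order_automorphism :: "'i set \<Rightarrow> 'i rel \<Rightarrow> ('i \<Rightarrow> 'i) \<Rightarrow> bool" where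
  "order_automorphism \<Phi> r \<tau> \<longleftrightarrow> bij_betw \<tau> \<Phi> \<Phi> \<and>
     (\<forall>\<phi> \<in> \<Phi>. \<forall>\<psi> \<in> \<Phi>. (\<phi>, \<psi>) \<in> r \<longleftrightarrow> (\<tau> \<phi>, \<tau> \<psi>) \<in> r)"

text \<open>The system of triangles $F^{i+1}X \to F^iX \to X_{\varphi_i} \to F^{i+1}X[1]$, with
  \<open>F i\<close> for $F^iX$ and \<open>Q i\<close> for $X_{\varphi_i}$; the equation $F^{n+1}X = 0$ says
  that $F^{n+1}X$ is a zero object.\<close>

definition t_filtration ::
  "('o, 'm, 'z) tri_cat_scheme \<Rightarrow> 'i set \<Rightarrow> 'i rel \<Rightarrow> ('i \<Rightarrow> 'o set) \<Rightarrow> 'o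
     \<Rightarrow> nat \<Rightarrow> (nat \<Rightarrow> 'o) \<Rightarrow> (nat \<Rightarrow> 'o) \<Rightarrow> (nat \<Rightarrow> 'i) \<Rightarrow> bool" where
  "t_filtration C \<Phi> r P X n F Q \<phi> \<longleftrightarrow>
     F 0 = X \<and> zero_object C (F (Suc n)) \<and>
     (\<forall>i \<le> n. (\<exists>f g h. distinguished C (F (Suc i)) (F i) (Q i) f g h) \<and>
        \<phi> i \<in> \<Phi> \<and> Q i \<in> P (\<phi> i) \<and> \<not> zero_object C (Q i)) \<and>
     (\<forall>i j. i < j \<and> j \<le> n \<longrightarrow> (\<phi> i, \<phi> j) \<in> r \<and> \<phi> i \<noteq> \<phi> j)"

definition t_stability ::
  "('o, 'm, 'z) tri_cat_scheme \<Rightarrow> 'i set \<Rightarrow> 'i rel \<Rightarrow> ('i \<Rightarrow> 'o set) \<Rightarrow> bool" where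
  "t_stability C \<Phi> r P \<longleftrightarrow>
     linear_order_on \<Phi> r \<and>
     (\<forall>\<phi> \<in> \<Phi>. P \<phi> \<noteq> {} \<and> strictly_full C (P \<phi>) \<and> extension_closed C (P \<phi>)) \<and>
     (\<exists>\<tau>. order_automorphism \<Phi> r \<tau> \<and>
        (\<forall>\<phi> \<in> \<Phi>. shift_sub C (P \<phi>) 1 = P (\<tau> \<phi>) \<and> (\<phi>, \<tau> \<phi>) \<in> r)) \<and>
     (\<forall>\<phi> \<in> \<Phi>. \<forall>\<psi> \<in> \<Phi>. (\<phi>, \<psi>) \<in> r \<and> \<phi> \<noteq> \<psi> \<longrightarrow>
        (\<forall>i \<le> 0. Hom_deg_vanishes C i (P \<psi>) (P \<phi>))) \<and>
     (\<forall>X \<in> Obj C. \<not> zero_object C X \<longrightarrow> (\<exists>n F Q \<phi>. t_filtration C \<Phi> r P X n F Q \<phi>))"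

end

theory Submission
  imports Defs
begin

text \<open>The two halves of a t-structure are orthogonal complements of each other:
  \<open>D_le n\<close> consists of the objects without nonzero morphisms to \<open>D_ge (n + 1)\<close>, and dually
  (\<open>in_D_le_if_orth\<close>, \<open>in_D_ge_if_orth\<close>). Membership in an orthogonal complement
  holds for zero objects and passes to isomorphic objects and, through the long exact sequences
  of \<open>Hom\<close>, to extensions. Hence all these closure properties hold for every \<open>D_le n\<close> and
  \<open>D_ge n\<close>, and so for their intersections, the shifted cores.

  The vanishing of \<open>Hom\<close> in degrees at most 0 is orthogonality with shifted indices: for
  \<open>i < j\<close> and \<open>k \<le> 0\<close>, the slice with index \<open>j\<close> lies in \<open>D_le (- j)\<close>, the slice with index \<open>i\<close>
  shifted by \<open>k\<close> lies in \<open>D_ge (- i - k)\<close>, and \<open>- j < - i - k\<close>.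

  The filtration of an object \<open>X\<close> splits off its highest cohomology object first. If \<open>X\<close> lies
  in \<open>D_ge m\<close> and in \<open>D_le n\<close>, truncation gives a triangle \<open>A \<rightarrow> X \<rightarrow> B\<close> with \<open>A\<close> in \<open>D_le (n - 1)\<close>
  and \<open>B\<close> in \<open>D_ge n\<close>. Closure under extensions, applied to the rotations of this triangle,
  puts \<open>B\<close> in the core shifted by \<open>- n\<close> and keeps \<open>A\<close> in \<open>D_ge m\<close>
  (\<open>top_cohomology_triangle\<close>). Induction on the width \<open>n + 1 - m\<close> filters \<open>A\<close> with slices of
  index greater than \<open>- n\<close>; width 0 forces \<open>X\<close> to be orthogonal to itself, that is, zero.\<close>

section \<open>Additive categories\<close>

context cat
begin

lemma Hom_Obj:
  assumes "f \<in> Hom C X Y"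
  shows "X \<in> Obj C" and "Y \<in> Obj C"
  using assms Dom_Obj Cod_Obj by (auto simp: Hom_def)

lemma isomorphicI:
  assumes "f \<in> Hom C X Y" "g \<in> Hom C Y X" "h \<in> Hom C Y X"
    and gf: "g \<cdot> f = Ident C X" and fh: "f \<cdot> h = Ident C Y"
  shows "isomorphic C X Y"
proof -
  \<comment> \<open>A left inverse and a right inverse coincide.\<close>
  have "g = g \<cdot> (f \<cdot> h)"
    using assms(2) fh by (simp add: Comp_Ident)
  also have "\<dots> = h"
    using Comp_assoc[OF assms(3,1,2)] assms(3) gf by (simp add: Ident_Comp)
  finally show ?thesis
    using assms unfolding isomorphic_def is_iso_def by blast
qed

lemma isomorphic_sym: "isomorphic C X Y \<Longrightarrow> isomorphic C Y X"
  unfolding isomorphic_def is_iso_def by blast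

end

context additive_cat
begin

abbreviation Neg :: "'o \<Rightarrow> 'o \<Rightarrow> 'm \<Rightarrow> 'm" where
  "Neg X Y f \<equiv> inv\<^bsub>Hom_group C X Y\<^esub> f"

definition orth :: "'o \<Rightarrow> 'o \<Rightarrow> bool" where
  "orth X Y \<longleftrightarrow> Hom C X Y = {Zero C X Y}"

lemma Hom_group_group:
  assumes "X \<in> Obj C" "Y \<in> Obj C"
  shows "group (Hom_group C X Y)"
  using Hom_comm_group[OF assms] by (rule comm_group.axioms)

lemma Hom_group_simps:
  "carrier (Hom_group C X Y) = Hom C X Y"
  "mult (Hom_group C X Y) = Add C"
  "one (Hom_group C X Y) = Zero C X Y"
  by (simp_all add: Hom_group_def)

lemma Zero_Hom:
  assumes "X \<in> Obj C" "Y \<in> Obj C"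
  shows "Zero C X Y \<in> Hom C X Y"
  using monoid.one_closed[OF group.is_monoid[OF Hom_group_group[OF assms]]]
  by (simp add: Hom_group_simps)

lemma Neg_Hom:
  assumes "f \<in> Hom C X Y"
  shows "Neg X Y f \<in> Hom C X Y"
  using group.inv_closed[OF Hom_group_group[OF Hom_Obj[OF assms]], of f] assms
  by (simp add: Hom_group_simps)

lemma Neg_Neg:
  assumes "f \<in> Hom C X Y"
  shows "Neg X Y (Neg X Y f) = f"
  using group.inv_inv[OF Hom_group_group[OF Hom_Obj[OF assms]], of f] assms
  by (simp add: Hom_group_simps)

lemma Add_Neg:
  assumes "f \<in> Hom C X Y"
  shows "Add C f (Neg X Y f) = Zero C X Y"
  using group.r_inv[OF Hom_group_group[OF Hom_Obj[OF assms]], of f] assms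
  by (simp add: Hom_group_simps)

lemma Neg_unique:
  assumes "f \<in> Hom C X Y" "g \<in> Hom C X Y" "Add C f g = Zero C X Y"
  shows "g = Neg X Y f"
proof -
  interpret G: comm_group "Hom_group C X Y"
    using Hom_comm_group[OF Hom_Obj[OF assms(1)]] .
  show ?thesis
    using G.inv_equality[of g f] G.m_comm[of f g] assms by (simp add: Hom_group_simps)
qed

lemma Zero_unique:
  assumes "f \<in> Hom C X Y" "Add C f f = f"
  shows "f = Zero C X Y"
  using group.l_cancel_one[OF Hom_group_group[OF Hom_Obj[OF assms(1)]], of f f] assms
  by (simp add: Hom_group_simps)

lemma Add_Zero_Zero:
  assumes "X \<in> Obj C" "Y \<in> Obj C"
  shows "Add C (Zero C X Y) (Zero C X Y) = Zero C X Y"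
  using monoid.l_one[OF group.is_monoid[OF Hom_group_group[OF assms]], of "Zero C X Y"]
    Zero_Hom[OF assms]
  by (simp add: Hom_group_simps)

lemma Comp_Zero:
  assumes "g \<in> Hom C Y Z" "X \<in> Obj C"
  shows "g \<cdot> Zero C X Y = Zero C X Z"
proof -
  have z: "Zero C X Y \<in> Hom C X Y"
    using Zero_Hom Hom_Obj assms by blast
  have "Add C (g \<cdot> Zero C X Y) (g \<cdot> Zero C X Y) = g \<cdot> Zero C X Y"
    using Comp_Add_right[OF z z assms(1)] Add_Zero_Zero Hom_Obj[OF z] by simp
  then show ?thesis
    using Zero_unique Comp_Hom[OF z assms(1)] by blast
qed

lemma Zero_Comp:
  assumes "f \<in> Hom C X Y" "Z \<in> Obj C"
  shows "Zero C Y Z \<cdot> f = Zero C X Z"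
proof -
  have z: "Zero C Y Z \<in> Hom C Y Z"
    using Zero_Hom Hom_Obj assms by blast
  have "Add C (Zero C Y Z \<cdot> f) (Zero C Y Z \<cdot> f) = Zero C Y Z \<cdot> f"
    using Comp_Add_left[OF assms(1) z z] Add_Zero_Zero Hom_Obj[OF z] by simp
  then show ?thesis
    using Zero_unique Comp_Hom[OF assms(1) z] by blast
qed

lemma Comp_Neg:
  assumes "f \<in> Hom C X Y" "g \<in> Hom C Y Z"
  shows "g \<cdot> Neg X Y f = Neg X Z (g \<cdot> f)"
proof (rule Neg_unique)
  show "Add C (g \<cdot> f) (g \<cdot> Neg X Y f) = Zero C X Z"
    using Comp_Add_right[OF assms(1) Neg_Hom[OF assms(1)] assms(2)] Add_Neg[OF assms(1)]
      Comp_Zero[OF assms(2)] Hom_Obj[OF assms(1)] by simp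
qed (use assms Neg_Hom Comp_Hom in blast)+

lemma Neg_Comp:
  assumes "f \<in> Hom C X Y" "g \<in> Hom C Y Z"
  shows "Neg Y Z g \<cdot> f = Neg X Z (g \<cdot> f)"
proof (rule Neg_unique)
  show "Add C (g \<cdot> f) (Neg Y Z g \<cdot> f) = Zero C X Z"
    using Comp_Add_left[OF assms(1) assms(2) Neg_Hom[OF assms(2)]] Add_Neg[OF assms(2)]
      Zero_Comp[OF assms(1)] Hom_Obj[OF assms(2)] by simp
qed (use assms Neg_Hom Comp_Hom in blast)+

lemma orthI:
  assumes "X \<in> Obj C" "Y \<in> Obj C" "\<And>f. f \<in> Hom C X Y \<Longrightarrow> f = Zero C X Y"
  shows "orth X Y"
  using assms Zero_Hom unfolding orth_def by blast

lemma orthD: "orth X Y \<Longrightarrow> f \<in> Hom C X Y \<Longrightarrow> f = Zero C X Y"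
  unfolding orth_def by blast

lemma zero_object_Obj: "zero_object C Z \<Longrightarrow> Z \<in> Obj C"
  unfolding zero_object_def by blast

lemma zero_object_orth:
  assumes "zero_object C Z" "X \<in> Obj C"
  shows "orth X Z" and "orth Z X"
proof -
  have Z: "Z \<in> Obj C"
    using zero_object_Obj[OF assms(1)] .
  have "\<exists>!f. f \<in> Hom C X Z" "\<exists>!f. f \<in> Hom C Z X"
    using assms unfolding zero_object_def by simp_all
  then show "orth X Z" "orth Z X"
    using orthI[OF assms(2) Z] orthI[OF Z assms(2)] Zero_Hom[OF assms(2) Z] Zero_Hom[OF Z assms(2)]
    by blast+
qed

lemma zero_object_if_Ident_eq_Zero:
  assumes "Z \<in> Obj C" "Ident C Z = Zero C Z Z"
  shows "zero_object C Z"
proof -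
  have "f = Zero C X Z" if "f \<in> Hom C X Z" for f X
    using Ident_Comp[OF that] Zero_Comp[OF that assms(1)] assms(2) by simp
  moreover have "f = Zero C Z X" if "f \<in> Hom C Z X" for f X
    using Comp_Ident[OF that] Comp_Zero[OF that assms(1)] assms(2) by simp
  ultimately show ?thesis
    using assms(1) Zero_Hom unfolding zero_object_def by blast
qed

lemma zero_object_if_orth_self: "Z \<in> Obj C \<Longrightarrow> orth Z Z \<Longrightarrow> zero_object C Z"
  using zero_object_if_Ident_eq_Zero orthD Ident_Hom by blast

lemma orth_isomorphic_left:
  assumes "isomorphic C X Y" "orth X W"
  shows "orth Y W"
proof -
  obtain f g where f: "f \<in> Hom C X Y" and g: "g \<in> Hom C Y X" and fg: "f \<cdot> g = Ident C Y"
    using assms(1) unfolding isomorphic_def is_iso_def by blast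
  have W: "W \<in> Obj C"
    using assms(2) Hom_Obj unfolding orth_def by blast
  show ?thesis
  proof (rule orthI)
    fix u assume u: "u \<in> Hom C Y W"
    have "u = (u \<cdot> f) \<cdot> g"
      using Comp_assoc[OF g f u] fg Comp_Ident[OF u] by simp
    also have "\<dots> = Zero C Y W"
      using orthD[OF assms(2) Comp_Hom[OF f u]] Zero_Comp[OF g W] by simp
    finally show "u = Zero C Y W" .
  qed (use f W Hom_Obj in blast)+
qed

lemma orth_isomorphic_right:
  assumes "isomorphic C X Y" "orth W X"
  shows "orth W Y"
proof -
  obtain f g where f: "f \<in> Hom C X Y" and g: "g \<in> Hom C Y X" and fg: "f \<cdot> g = Ident C Y"
    using assms(1) unfolding isomorphic_def is_iso_def by blast
  have W: "W \<in> Obj C"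
    using assms(2) Hom_Obj unfolding orth_def by blast
  show ?thesis
  proof (rule orthI)
    fix u assume u: "u \<in> Hom C W Y"
    have "u = f \<cdot> (g \<cdot> u)"
      using Comp_assoc[OF u g f] fg Ident_Comp[OF u] by simp
    also have "\<dots> = Zero C W Y"
      using orthD[OF assms(2) Comp_Hom[OF u g]] Comp_Zero[OF f W] by simp
    finally show "u = Zero C W Y" .
  qed (use f W Hom_Obj in blast)+
qed

end


section \<open>The translation functor\<close>

context triangulated_cat
begin

lemma Sh_obj_Obj: "X \<in> Obj C \<Longrightarrow> Sh_obj C X \<in> Obj C"
  using Sh_obj_bij bij_betwE by blast

lemma Sh_obj_inject: "X \<in> Obj C \<Longrightarrow> Y \<in> Obj C \<Longrightarrow> Sh_obj C X = Sh_obj C Y \<Longrightarrow> X = Y"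
  using Sh_obj_bij unfolding bij_betw_def inj_on_def by blast

lemma inv_Sh_obj:
  assumes "X \<in> Obj C"
  shows "inv_into (Obj C) (Sh_obj C) X \<in> Obj C"
    and "Sh_obj C (inv_into (Obj C) (Sh_obj C) X) = X"
  using assms Sh_obj_bij unfolding bij_betw_def by (auto intro: inv_into_into f_inv_into_f)

text \<open>Bijectivity of the translation on all arrows restricts to each \<open>Hom\<close> set, because
  injectivity on objects determines the domain and codomain of a preimage.\<close>

lemma Sh_arr_onto:
  assumes "X \<in> Obj C" "Y \<in> Obj C" "g \<in> Hom C (Sh_obj C X) (Sh_obj C Y)"
  obtains f where "f \<in> Hom C X Y" "Sh_arr C f = g"
proof -
  have "g \<in> Sh_arr C ` Arr C"
    using assms(3) Sh_arr_bij unfolding Hom_def bij_betw_def by blast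
  then obtain f where f: "f \<in> Arr C" "g = Sh_arr C f"
    by blast
  then have "f \<in> Hom C (Dom C f) (Cod C f)"
    by (simp add: Hom_def)
  moreover from Sh_arr_Hom[OF this] assms(3) f
  have "Sh_obj C (Dom C f) = Sh_obj C X" "Sh_obj C (Cod C f) = Sh_obj C Y"
    by (auto simp: Hom_def)
  then have "Dom C f = X" "Cod C f = Y"
    using Sh_obj_inject assms f Dom_Obj Cod_Obj by blast+
  ultimately show thesis
    using that f by blast
qed

lemma Sh_arr_inject:
  assumes "f \<in> Hom C X Y" "g \<in> Hom C X Y" "Sh_arr C f = Sh_arr C g"
  shows "f = g"
  using assms Sh_arr_bij unfolding Hom_def bij_betw_def inj_on_def by blast

lemma Sh_arr_Zero:
  assumes "X \<in> Obj C" "Y \<in> Obj C"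
  shows "Sh_arr C (Zero C X Y) = Zero C (Sh_obj C X) (Sh_obj C Y)"
  using Zero_unique[OF Sh_arr_Hom[OF Zero_Hom[OF assms]]]
    Sh_arr_Add[OF Zero_Hom[OF assms] Zero_Hom[OF assms]] Add_Zero_Zero[OF assms] by simp

lemma orth_Sh_obj_iff:
  assumes "X \<in> Obj C" "Y \<in> Obj C"
  shows "orth (Sh_obj C X) (Sh_obj C Y) \<longleftrightarrow> orth X Y"
proof
  assume o: "orth (Sh_obj C X) (Sh_obj C Y)"
  show "orth X Y"
  proof (rule orthI)
    fix f assume f: "f \<in> Hom C X Y"
    have "Sh_arr C f = Sh_arr C (Zero C X Y)"
      using orthD[OF o Sh_arr_Hom[OF f]] Sh_arr_Zero assms by simp
    then show "f = Zero C X Y"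
      using Sh_arr_inject f Zero_Hom assms by blast
  qed (use assms in auto)
next
  assume o: "orth X Y"
  show "orth (Sh_obj C X) (Sh_obj C Y)"
  proof (rule orthI)
    fix g assume "g \<in> Hom C (Sh_obj C X) (Sh_obj C Y)"
    then obtain f where "f \<in> Hom C X Y" "Sh_arr C f = g"
      using Sh_arr_onto assms by blast
    then show "g = Zero C (Sh_obj C X) (Sh_obj C Y)"
      using orthD[OF o] Sh_arr_Zero assms by auto
  qed (use assms Sh_obj_Obj in auto)
qed

lemma zero_object_Sh_obj:
  assumes "zero_object C Z"
  shows "zero_object C (Sh_obj C Z)"
proof -
  have Z: "Z \<in> Obj C"
    using zero_object_Obj[OF assms] .
  have "orth (Sh_obj C Z) (Sh_obj C Z)"
    using orth_Sh_obj_iff[OF Z Z] zero_object_orth(1)[OF assms Z] by simp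
  then show ?thesis
    using zero_object_if_orth_self[OF Sh_obj_Obj[OF Z]] by simp
qed

lemma shift_0: "shift C 0 X = X"
  by (simp add: shift_def)

lemma shift_Obj:
  assumes "X \<in> Obj C"
  shows "shift C n X \<in> Obj C"
proof -
  have "(Sh_obj C ^^ k) X \<in> Obj C" "(inv_into (Obj C) (Sh_obj C) ^^ k) X \<in> Obj C" for k
    using assms Sh_obj_Obj inv_Sh_obj by (induction k) auto
  then show ?thesis
    by (simp add: shift_def)
qed

lemma shift_Suc:
  assumes "X \<in> Obj C"
  shows "shift C (n + 1) X = Sh_obj C (shift C n X)"
proof (cases "0 \<le> n")
  case True
  then show ?thesis
    by (simp add: shift_def nat_add_distrib)
next
  case False
  then have eq: "nat (- n) = Suc (nat (- (n + 1)))"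
    by simp
  have "shift C (n + 1) X = (inv_into (Obj C) (Sh_obj C) ^^ nat (- (n + 1))) X"
    using False by (auto simp: shift_def)
  moreover have "shift C n X
      = inv_into (Obj C) (Sh_obj C) ((inv_into (Obj C) (Sh_obj C) ^^ nat (- (n + 1))) X)"
    using False unfolding shift_def eq by simp
  ultimately show ?thesis
    using inv_Sh_obj(2) shift_Obj[OF assms] by metis
qed

lemma shift_1: "X \<in> Obj C \<Longrightarrow> shift C 1 X = Sh_obj C X"
  using shift_Suc[of X 0] by (simp add: shift_0)

lemma shift_shift:
  assumes "X \<in> Obj C"
  shows "shift C m (shift C n X) = shift C (m + n) X"
proof (induction m rule: int_induct[where k = 0])
  case base
  then show ?case
    by (simp add: shift_0)
next
  case (step1 m)
  then show ?case
    using shift_Suc[OF assms, of "m + n"] shift_Suc[OF shift_Obj[OF assms], of m n]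
    by (simp add: algebra_simps)
next
  case (step2 m)
  have "Sh_obj C (shift C (m - 1) (shift C n X)) = Sh_obj C (shift C (m - 1 + n) X)"
    using step2 shift_Suc[OF assms, of "m - 1 + n"] shift_Suc[OF shift_Obj[OF assms], of "m - 1" n]
    by (simp add: algebra_simps)
  then show ?case
    using Sh_obj_inject shift_Obj assms by blast
qed

lemma orth_shift_iff:
  assumes "X \<in> Obj C" "Y \<in> Obj C"
  shows "orth (shift C n X) (shift C n Y) \<longleftrightarrow> orth X Y"
proof (induction n rule: int_induct[where k = 0])
  case base
  then show ?case
    by (simp add: shift_0)
next
  case (step1 n)
  then show ?case
    using orth_Sh_obj_iff shift_Obj shift_Suc assms by simp
next
  case (step2 n)
  then show ?case
    using orth_Sh_obj_iff[of "shift C (n - 1) X" "shift C (n - 1) Y"] shift_Obj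
      shift_Suc[of _ "n - 1"] assms by simp
qed

lemma shift_sub_iff:
  assumes "S \<subseteq> Obj C" "X \<in> Obj C"
  shows "X \<in> shift_sub C S n \<longleftrightarrow> shift C (- n) X \<in> S"
proof
  assume "X \<in> shift_sub C S n"
  then show "shift C (- n) X \<in> S"
    using assms(1) shift_shift by (auto simp: shift_sub_def shift_0 subset_iff)
next
  assume "shift C (- n) X \<in> S"
  then have "shift C n (shift C (- n) X) \<in> shift_sub C S n"
    by (simp add: shift_sub_def)
  then show "X \<in> shift_sub C S n"
    using assms(2) shift_shift by (simp add: shift_0)
qed

lemma shift_sub_Obj: "S \<subseteq> Obj C \<Longrightarrow> shift_sub C S n \<subseteq> Obj C"
  using shift_Obj by (auto simp: shift_sub_def)


section \<open>Distinguished triangles\<close>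

text \<open>Forgetting the morphisms also forgets the signs that rotation introduces, so that
  \<open>tri\<close> is invariant under the translation itself.\<close>

definition tri :: "'o \<Rightarrow> 'o \<Rightarrow> 'o \<Rightarrow> bool" where
  "tri X Y Z \<longleftrightarrow> (\<exists>f g h. distinguished C X Y Z f g h)"

lemma distinguished_Hom:
  assumes "distinguished C X Y Z f g h"
  shows "f \<in> Hom C X Y" "g \<in> Hom C Y Z" "h \<in> Hom C Z (Sh_obj C X)"
  using assms unfolding distinguished_def triangle_def by auto

lemma tri_Obj:
  assumes "tri X Y Z"
  shows "X \<in> Obj C" "Y \<in> Obj C" "Z \<in> Obj C"
  using assms distinguished_Hom Hom_Obj unfolding tri_def by meson+

lemma distinguished_rotate:
  assumes "distinguished C X Y Z f g h"
  shows "distinguished C Y Z (Sh_obj C X) g h (Neg (Sh_obj C X) (Sh_obj C Y) (Sh_arr C f))"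
  using assms TR2 unfolding distinguished_def by blast

lemma distinguished_rotate_back:
  assumes "distinguished C X Y (Sh_obj C Z) f g h" "Z \<in> Obj C"
  obtains k where "distinguished C Z X Y k f g"
proof -
  note hom = distinguished_Hom[OF assms(1)]
  obtain k where k: "k \<in> Hom C Z X" "Sh_arr C k = Neg (Sh_obj C Z) (Sh_obj C X) h"
    using Sh_arr_onto[OF assms(2) Hom_Obj(1)[OF hom(1)] Neg_Hom[OF hom(3)]] by blast
  then have "distinguished C Z X Y k f g"
    using TR2[of Z X Y k f g] assms(1) hom Neg_Neg[OF hom(3)] by (simp add: triangle_def)
  then show thesis
    by (rule that)
qed

lemma tri_rotate: "tri X Y Z \<Longrightarrow> tri Y Z (Sh_obj C X)"
  using distinguished_rotate unfolding tri_def by blast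

lemma tri_rotate_back: "tri X Y (Sh_obj C Z) \<Longrightarrow> Z \<in> Obj C \<Longrightarrow> tri Z X Y"
  using distinguished_rotate_back unfolding tri_def by metis

text \<open>Up to signs, translating a triangle is rotating it three times.\<close>

lemma tri_Sh_obj_iff:
  assumes "X \<in> Obj C" "Y \<in> Obj C" "Z \<in> Obj C"
  shows "tri (Sh_obj C X) (Sh_obj C Y) (Sh_obj C Z) \<longleftrightarrow> tri X Y Z"
proof
  assume "tri (Sh_obj C X) (Sh_obj C Y) (Sh_obj C Z)"
  then show "tri X Y Z"
    using tri_rotate_back assms by meson
next
  assume "tri X Y Z"
  then show "tri (Sh_obj C X) (Sh_obj C Y) (Sh_obj C Z)"
    by (intro tri_rotate)
qed

lemma tri_shift_iff:
  assumes "X \<in> Obj C" "Y \<in> Obj C" "Z \<in> Obj C"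
  shows "tri (shift C n X) (shift C n Y) (shift C n Z) \<longleftrightarrow> tri X Y Z"
proof (induction n rule: int_induct[where k = 0])
  case base
  then show ?case
    by (simp add: shift_0)
next
  case (step1 n)
  then show ?case
    using tri_Sh_obj_iff shift_Obj shift_Suc assms by simp
next
  case (step2 n)
  then show ?case
    using tri_Sh_obj_iff[of "shift C (n - 1) X" "shift C (n - 1) Y" "shift C (n - 1) Z"]
      shift_Obj shift_Suc[of _ "n - 1"] assms by simp
qed

text \<open>Exactness of \<open>Hom(W, -)\<close> at \<open>Y\<close>. The morphism \<open>u\<close> and zero form a commutative square
  from the rotated identity triangle \<open>W \<rightarrow> 0 \<rightarrow> W[1]\<close> to the rotation \<open>Y \<rightarrow> Z \<rightarrow> X[1]\<close>; the third
  component that completes it is the translate of the factorization.\<close>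

lemma factor_through_cocone:
  assumes dist: "distinguished C X Y Z f g h"
    and u: "u \<in> Hom C W Y" and gu: "g \<cdot> u = Zero C W Z"
  obtains v where "v \<in> Hom C W X" "f \<cdot> v = u"
proof -
  note hom = distinguished_Hom[OF dist]
  obtain N where N: "zero_object C N"
    using ex_zero_object by blast
  have ob: "N \<in> Obj C" "W \<in> Obj C" "X \<in> Obj C" "Y \<in> Obj C" "Z \<in> Obj C"
    using zero_object_Obj[OF N] Hom_Obj[OF u] Hom_Obj[OF hom(1)] Hom_Obj[OF hom(2)] by blast+
  have id: "Ident C (Sh_obj C W) \<in> Hom C (Sh_obj C W) (Sh_obj C W)"
    using Ident_Hom Sh_obj_Obj ob by blast
  have "distinguished C W N (Sh_obj C W) (Zero C W N) (Zero C N (Sh_obj C W))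
      (Neg (Sh_obj C W) (Sh_obj C W) (Ident C (Sh_obj C W)))"
    using distinguished_rotate[OF TR1_ident[OF ob(2) N]] Sh_arr_Ident ob by simp
  moreover have "Zero C N Z \<cdot> Zero C W N = g \<cdot> u"
    using gu Comp_Zero[OF Zero_Hom[OF ob(1,5)] ob(2)] by simp
  ultimately obtain c where c: "c \<in> Hom C (Sh_obj C W) (Sh_obj C X)"
    and eq: "Sh_arr C u \<cdot> Neg (Sh_obj C W) (Sh_obj C W) (Ident C (Sh_obj C W))
      = Neg (Sh_obj C X) (Sh_obj C Y) (Sh_arr C f) \<cdot> c"
    using TR3[OF _ distinguished_rotate[OF dist] u Zero_Hom[OF ob(1,5)]] by blast
  note Su = Sh_arr_Hom[OF u] and Sf = Sh_arr_Hom[OF hom(1)]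
  have "Neg (Sh_obj C W) (Sh_obj C Y) (Sh_arr C u)
      = Neg (Sh_obj C W) (Sh_obj C Y) (Sh_arr C f \<cdot> c)"
    using eq Comp_Neg[OF id Su] Comp_Ident[OF Su] Neg_Comp[OF c Sf] by simp
  then have "Sh_arr C u = Sh_arr C f \<cdot> c"
    using Neg_Neg[OF Su] Neg_Neg[OF Comp_Hom[OF c Sf]] by metis
  moreover obtain v where v: "v \<in> Hom C W X" "Sh_arr C v = c"
    using Sh_arr_onto[OF ob(2,3) c] by blast
  ultimately have "Sh_arr C (f \<cdot> v) = Sh_arr C u"
    using Sh_arr_Comp[OF v(1) hom(1)] by simp
  then have "f \<cdot> v = u"
    using Sh_arr_inject Comp_Hom[OF v(1) hom(1)] u by blast
  with v show thesis
    using that by blast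
qed

text \<open>Exactness of \<open>Hom(-, W)\<close> at \<open>Y\<close>, from completing zero and \<open>u\<close> to a morphism into
  the triangle \<open>0 \<rightarrow> W \<rightarrow> W\<close>.\<close>

lemma factor_through_cone:
  assumes dist: "distinguished C X Y Z f g h"
    and u: "u \<in> Hom C Y W" and uf: "u \<cdot> f = Zero C X W"
  obtains v where "v \<in> Hom C Z W" "v \<cdot> g = u"
proof -
  note hom = distinguished_Hom[OF dist]
  obtain N where N: "zero_object C N"
    using ex_zero_object by blast
  have ob: "N \<in> Obj C" "W \<in> Obj C" "X \<in> Obj C"
    using zero_object_Obj[OF N] Hom_Obj[OF u] Hom_Obj[OF hom(1)] Hom_Obj[OF hom(2)] by blast+
  \<comment> \<open>The identity triangle ends in the zero object \<open>N[1]\<close> so that rotating it back starts in \<open>N\<close>.\<close>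
  obtain k where k: "distinguished C N W W k (Ident C W) (Zero C W (Sh_obj C N))"
    using distinguished_rotate_back[OF TR1_ident[OF ob(2) zero_object_Sh_obj[OF N]] ob(1)] by blast
  have "k = Zero C N W"
    using orthD zero_object_orth(2)[OF N ob(2)] distinguished_Hom(1)[OF k] by blast
  then have "u \<cdot> f = k \<cdot> Zero C X N"
    using uf Comp_Zero[OF Zero_Hom[OF ob(1,2)] ob(3)] by simp
  then obtain v where "v \<in> Hom C Z W" "v \<cdot> g = Ident C W \<cdot> u"
    using TR3[OF dist k Zero_Hom[OF ob(3,1)] u] by blast
  then show thesis
    using that Ident_Comp[OF u] by simp
qed

lemma orth_tri_left:
  assumes "tri X Y Z" "orth X W" "orth Z W"
  shows "orth Y W"
proof -
  obtain f g h where dist: "distinguished C X Y Z f g h"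
    using assms(1) unfolding tri_def by blast
  note hom = distinguished_Hom[OF dist]
  have W: "W \<in> Obj C"
    using assms(2) Hom_Obj unfolding orth_def by blast
  show ?thesis
  proof (rule orthI)
    fix u assume u: "u \<in> Hom C Y W"
    obtain v where "v \<in> Hom C Z W" "v \<cdot> g = u"
      using factor_through_cone[OF dist u] orthD[OF assms(2) Comp_Hom[OF hom(1) u]] by blast
    then show "u = Zero C Y W"
      using orthD[OF assms(3)] Zero_Comp[OF hom(2) W] by auto
  qed (use W hom Hom_Obj in blast)+
qed

lemma orth_tri_right:
  assumes "tri X Y Z" "orth W X" "orth W Z"
  shows "orth W Y"
proof -
  obtain f g h where dist: "distinguished C X Y Z f g h"
    using assms(1) unfolding tri_def by blast
  note hom = distinguished_Hom[OF dist]
  have W: "W \<in> Obj C"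
    using assms(2) Hom_Obj unfolding orth_def by blast
  show ?thesis
  proof (rule orthI)
    fix u assume u: "u \<in> Hom C W Y"
    obtain v where "v \<in> Hom C W X" "f \<cdot> v = u"
      using factor_through_cocone[OF dist u] orthD[OF assms(3) Comp_Hom[OF u hom(2)]] by blast
    then show "u = Zero C W Y"
      using orthD[OF assms(2)] Comp_Zero[OF hom(1) W] by auto
  qed (use W hom Hom_Obj in blast)+
qed

text \<open>Lifting the identity of \<open>Y\<close> along \<open>X \<rightarrow> Y\<close> gives a right inverse, as the obstruction
  lies in \<open>Hom(Y, Z)\<close>. Extending the identity of \<open>X\<close> along the same morphism gives a left
  inverse, as the obstruction lies in \<open>Hom(Z[-1], X)\<close>.\<close>

lemma isomorphic_if_zero_cone:
  assumes "tri X Y Z" "zero_object C Z"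
  shows "isomorphic C X Y"
proof -
  obtain f g h where dist: "distinguished C X Y Z f g h"
    using assms(1) unfolding tri_def by blast
  note hom = distinguished_Hom[OF dist]
  have ob: "X \<in> Obj C" "Y \<in> Obj C" "Z \<in> Obj C"
    using hom Hom_Obj by blast+
  obtain Z' where Z': "Z' \<in> Obj C" "Sh_obj C Z' = Z"
    using inv_Sh_obj[OF ob(3)] by blast
  then obtain k where k: "distinguished C Z' X Y k f g"
    using distinguished_rotate_back dist by metis
  have idX: "Ident C X \<in> Hom C X X" and idY: "Ident C Y \<in> Hom C Y Y"
    using Ident_Hom ob by blast+
  obtain s where s: "s \<in> Hom C Y X" "f \<cdot> s = Ident C Y"
    using factor_through_cocone[OF dist idY]
      orthD[OF zero_object_orth(1)[OF assms(2) ob(2)] Comp_Hom[OF idY hom(2)]] by blast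
  have "orth Z' X"
    using orth_Sh_obj_iff[OF Z'(1) ob(1)] Z'(2)
      zero_object_orth(2)[OF assms(2) Sh_obj_Obj[OF ob(1)]] by simp
  then obtain r where r: "r \<in> Hom C Y X" "r \<cdot> f = Ident C X"
    using factor_through_cone[OF k idX]
      orthD[OF _ Comp_Hom[OF distinguished_Hom(1)[OF k] idX]] by blast
  show ?thesis
    using isomorphicI[OF hom(1) r(1) s(1) r(2) s(2)] .
qed

lemma isomorphic_if_zero_cocone:
  assumes "tri X Y Z" "zero_object C X"
  shows "isomorphic C Y Z"
  using isomorphic_if_zero_cone[OF tri_rotate[OF assms(1)] zero_object_Sh_obj[OF assms(2)]] .

end


section \<open>t-structures\<close>

locale t_structured_cat = triangulated_cat C
  for C :: "('o, 'm, 'z) tri_cat_scheme" (structure) +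
  fixes L R :: "'o set"
  assumes t_structure: "t_structure C L R"
begin

lemma L_Obj: "L \<subseteq> Obj C" and R_Obj: "R \<subseteq> Obj C"
  using t_structure by (simp_all add: t_structure_def strictly_full_def)

lemma D_le_iff: "X \<in> D_le C L n \<longleftrightarrow> X \<in> Obj C \<and> shift C n X \<in> L"
  using shift_sub_iff[OF L_Obj, of X "- n"] subsetD[OF shift_sub_Obj[OF L_Obj, of "- n"], of X]
  unfolding D_le_def by fastforce

lemma D_ge_iff: "X \<in> D_ge C R n \<longleftrightarrow> X \<in> Obj C \<and> shift C n X \<in> R"
  using shift_sub_iff[OF R_Obj, of X "- n"] subsetD[OF shift_sub_Obj[OF R_Obj, of "- n"], of X]
  unfolding D_ge_def by fastforce

lemma D_le_Obj: "X \<in> D_le C L n \<Longrightarrow> X \<in> Obj C" and D_ge_Obj: "X \<in> D_ge C R n \<Longrightarrow> X \<in> Obj C"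
  by (simp_all add: D_le_iff D_ge_iff)

lemma shift_D_le_iff: "X \<in> Obj C \<Longrightarrow> shift C k X \<in> D_le C L n \<longleftrightarrow> X \<in> D_le C L (n + k)"
  by (simp add: D_le_iff shift_Obj shift_shift)

lemma shift_D_ge_iff: "X \<in> Obj C \<Longrightarrow> shift C k X \<in> D_ge C R n \<longleftrightarrow> X \<in> D_ge C R (n + k)"
  by (simp add: D_ge_iff shift_Obj shift_shift)

lemma D_le_0: "D_le C L 0 = L" and D_ge_0: "D_ge C R 0 = R"
  using L_Obj R_Obj by (auto simp: D_le_iff D_ge_iff shift_0)

lemma D_le_mono:
  assumes "m \<le> n" "X \<in> D_le C L m"
  shows "X \<in> D_le C L n"
  using assms(1)
proof (induction n rule: int_ge_induct)
  case base
  then show ?case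
    using assms by simp
next
  case (step n)
  have X: "X \<in> Obj C"
    using step.IH D_le_Obj by blast
  have "shift C n X \<in> D_le C L 1"
    using step.IH t_structure unfolding t_structure_def by (auto simp: D_le_iff)
  then show ?case
    using shift_D_le_iff[OF X] by (simp add: add.commute)
qed

lemma D_ge_antimono:
  assumes "m \<le> n" "X \<in> D_ge C R n"
  shows "X \<in> D_ge C R m"
  using assms(1)
proof (induction m rule: int_le_induct)
  case base
  then show ?case
    using assms by simp
next
  case (step m)
  have X: "X \<in> Obj C"
    using step.IH D_ge_Obj by blast
  have "shift C (m - 1) X \<in> D_ge C R 1"
    using step.IH shift_D_ge_iff[OF X] by simp
  then show ?case
    using t_structure X unfolding t_structure_def by (auto simp: D_ge_iff)
qed

lemma orth_D_le_D_ge: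
  assumes "m < n" "X \<in> D_le C L m" "Y \<in> D_ge C R n"
  shows "orth X Y"
proof -
  have X: "X \<in> Obj C" and Y: "Y \<in> Obj C"
    using assms D_le_Obj D_ge_Obj by blast+
  have "Y \<in> D_ge C R (m + 1)"
    using D_ge_antimono[OF _ assms(3), of "m + 1"] assms(1) by simp
  then have "shift C m Y \<in> D_ge C R 1"
    using shift_D_ge_iff[OF Y] by (simp add: add.commute)
  moreover have "shift C m X \<in> L"
    using assms by (simp add: D_le_iff)
  ultimately have "orth (shift C m X) (shift C m Y)"
    using t_structure unfolding t_structure_def Hom_deg_vanishes_def Hom_deg_def orth_def
    by (simp add: shift_0)
  then show ?thesis
    using orth_shift_iff X Y by blast
qed

text \<open>The axiom gives truncation at 0; truncation of \<open>X\<close> at \<open>n\<close> is truncation of \<open>X[n]\<close> at 0,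
  shifted back.\<close>

lemma truncation:
  assumes "X \<in> Obj C"
  obtains A B where "A \<in> D_le C L n" "B \<in> D_ge C R (n + 1)" "tri A X B"
proof -
  obtain A B where A: "A \<in> L" and B: "B \<in> D_ge C R 1" and "tri A (shift C n X) B"
    using t_structure shift_Obj[OF assms] unfolding t_structure_def tri_def by meson
  moreover have ob: "A \<in> Obj C" "B \<in> Obj C"
    using A B L_Obj D_ge_Obj by blast+
  ultimately have "tri (shift C (- n) A) X (shift C (- n) B)"
    using tri_shift_iff[of A "shift C n X" B "- n"] assms
    by (simp add: shift_Obj shift_shift shift_0)
  moreover have "shift C (- n) A \<in> D_le C L n" "shift C (- n) B \<in> D_ge C R (n + 1)"
    using A B ob shift_D_le_iff shift_D_ge_iff by (simp_all add: D_le_0)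
  ultimately show thesis
    using that by blast
qed

text \<open>Truncate \<open>X[n]\<close> as \<open>A \<rightarrow> X[n] \<rightarrow> B\<close>. Both \<open>X[n]\<close> and \<open>A[1]\<close> are orthogonal to \<open>B\<close>, hence so
  is the extension \<open>B\<close> of \<open>A[1]\<close> by \<open>X[n]\<close>. Thus \<open>B\<close> vanishes and \<open>X[n]\<close> is isomorphic to
  \<open>A\<close>. Working with \<open>X[n]\<close> in place of \<open>X\<close> allows the use of strict fullness of \<open>L\<close> itself.\<close>

lemma in_D_le_if_orth:
  assumes X: "X \<in> Obj C" and orth: "\<And>Y. Y \<in> D_ge C R (n + 1) \<Longrightarrow> orth X Y"
  shows "X \<in> D_le C L n"
proof -
  let ?X = "shift C n X"
  have X': "?X \<in> Obj C"
    using X shift_Obj by blast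
  obtain A B where A: "A \<in> D_le C L 0" and B: "B \<in> D_ge C R 1" and tri: "tri A ?X B"
    using truncation[OF X', of 0] by auto
  have ob: "A \<in> Obj C" "B \<in> Obj C"
    using A B D_le_Obj D_ge_Obj by blast+
  have "orth X (shift C (- n) B)"
    using orth shift_D_ge_iff[OF ob(2)] B by simp
  then have "orth ?X B"
    using orth_shift_iff[OF X shift_Obj[OF ob(2)], of n "- n"] by (simp add: shift_shift ob shift_0)
  moreover have "orth (Sh_obj C A) B"
  proof (rule orth_D_le_D_ge[OF _ _ B])
    show "Sh_obj C A \<in> D_le C L (- 1)"
      using A shift_D_le_iff[OF ob(1), of 1 "- 1"] shift_1 ob by simp
  qed simp
  ultimately have "orth B B"
    using orth_tri_left[OF tri_rotate[OF tri]] by blast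
  then have "isomorphic C A ?X"
    using isomorphic_if_zero_cone[OF tri] zero_object_if_orth_self ob by blast
  then have "?X \<in> L"
    using A X' t_structure unfolding D_le_0 t_structure_def strictly_full_def by blast
  then show ?thesis
    using X by (simp add: D_le_iff)
qed

text \<open>The dual argument: truncation of \<open>Y[n]\<close> at -1 gives \<open>A \<rightarrow> Y[n] \<rightarrow> B\<close>, and \<open>A\<close> is
  orthogonal to the outer terms of \<open>B[-1] \<rightarrow> A \<rightarrow> Y[n]\<close>, hence to itself.\<close>

lemma in_D_ge_if_orth:
  assumes Y: "Y \<in> Obj C" and orth: "\<And>X. X \<in> D_le C L (n - 1) \<Longrightarrow> orth X Y"
  shows "Y \<in> D_ge C R n"
proof -
  let ?Y = "shift C n Y"
  have Y': "?Y \<in> Obj C"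
    using Y shift_Obj by blast
  obtain A B where A: "A \<in> D_le C L (- 1)" and B: "B \<in> D_ge C R 0" and tri: "tri A ?Y B"
    using truncation[OF Y', of "- 1"] by auto
  have ob: "A \<in> Obj C" "B \<in> Obj C"
    using A B D_le_Obj D_ge_Obj by blast+
  have "orth (shift C (- n) A) Y"
    using orth shift_D_le_iff[OF ob(1)] A by simp
  then have "orth A ?Y"
    using orth_shift_iff[OF shift_Obj[OF ob(1)] Y, of n "- n"] by (simp add: shift_shift ob shift_0)
  moreover define B' where "B' = shift C (- 1) B"
  have B': "B' \<in> Obj C" "Sh_obj C B' = B"
    using ob shift_Suc[of B "- 1"] shift_Obj by (auto simp: B'_def shift_0)
  have "orth A B'"
  proof (rule orth_D_le_D_ge[OF _ A])
    show "B' \<in> D_ge C R 1"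
      using B shift_D_ge_iff[OF ob(2)] by (simp add: B'_def)
  qed simp
  ultimately have "orth A A"
    using orth_tri_right tri_rotate_back[of A ?Y B'] tri B' by blast
  then have "isomorphic C B ?Y"
    using isomorphic_if_zero_cocone[OF tri] zero_object_if_orth_self ob isomorphic_sym by blast
  then have "?Y \<in> R"
    using B Y' t_structure unfolding D_ge_0 t_structure_def strictly_full_def by blast
  then show ?thesis
    using Y by (simp add: D_ge_iff)
qed

lemma D_le_isomorphic:
  assumes "isomorphic C X Y" "X \<in> D_le C L n" "Y \<in> Obj C"
  shows "Y \<in> D_le C L n"
  using in_D_le_if_orth[OF assms(3)] orth_isomorphic_left[OF assms(1)]
    orth_D_le_D_ge[OF _ assms(2), of "n + 1"] by simp

lemma D_ge_isomorphic:
  assumes "isomorphic C X Y" "X \<in> D_ge C R n" "Y \<in> Obj C"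
  shows "Y \<in> D_ge C R n"
  using in_D_ge_if_orth[OF assms(3)] orth_isomorphic_right[OF assms(1)]
    orth_D_le_D_ge[OF _ _ assms(2), of "n - 1"] by simp

lemma D_le_extension:
  assumes "tri X Y Z" "X \<in> D_le C L n" "Z \<in> D_le C L n"
  shows "Y \<in> D_le C L n"
  using in_D_le_if_orth[OF tri_Obj(2)[OF assms(1)]] orth_tri_left[OF assms(1)]
    orth_D_le_D_ge[OF _ assms(2), of "n + 1"] orth_D_le_D_ge[OF _ assms(3), of "n + 1"] by simp

lemma D_ge_extension:
  assumes "tri X Y Z" "X \<in> D_ge C R n" "Z \<in> D_ge C R n"
  shows "Y \<in> D_ge C R n"
  using in_D_ge_if_orth[OF tri_Obj(2)[OF assms(1)]] orth_tri_right[OF assms(1)]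
    orth_D_le_D_ge[OF _ _ assms(2), of "n - 1"] orth_D_le_D_ge[OF _ _ assms(3), of "n - 1"] by simp

lemma zero_object_in_D_le: "zero_object C Z \<Longrightarrow> Z \<in> D_le C L n"
  using in_D_le_if_orth zero_object_orth(2) D_ge_Obj zero_object_Obj by blast

lemma zero_object_in_D_ge: "zero_object C Z \<Longrightarrow> Z \<in> D_ge C R n"
  using in_D_ge_if_orth zero_object_orth(1) D_le_Obj zero_object_Obj by blast

lemma shift_core: "shift_sub C (core L R) i = D_le C L (- i) \<inter> D_ge C R (- i)"
proof -
  have sub: "core L R \<subseteq> Obj C"
    using L_Obj by (auto simp: core_def)
  have "X \<in> shift_sub C (core L R) i \<longleftrightarrow> X \<in> D_le C L (- i) \<inter> D_ge C R (- i)"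
    if "X \<in> Obj C" for X
    using shift_sub_iff[OF sub that] that by (simp add: D_le_iff D_ge_iff core_def)
  then show ?thesis
    using shift_sub_Obj[OF sub] D_le_Obj by blast
qed

text \<open>The object \<open>B\<close> is an extension of \<open>A[1]\<close> by \<open>X\<close>, both in \<open>D_le n\<close>, and \<open>A\<close> is an extension
  of \<open>X\<close> by \<open>B[-1]\<close>, both in \<open>D_ge m\<close>; the latter uses \<open>B[-1]\<close> in \<open>D_ge (n + 1)\<close> and
  \<open>m \<le> n\<close>.\<close>

lemma top_cohomology_triangle:
  assumes "m \<le> n" "X \<in> D_ge C R m" "X \<in> D_le C L n"
  obtains A B where "tri A X B" "A \<in> D_ge C R m" "A \<in> D_le C L (n - 1)"
    "B \<in> shift_sub C (core L R) (- n)"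
proof -
  obtain A B where A: "A \<in> D_le C L (n - 1)" and B: "B \<in> D_ge C R n" and tri: "tri A X B"
    using truncation[OF D_le_Obj[OF assms(3)], of "n - 1"] by auto
  note ob = tri_Obj[OF tri]
  have "Sh_obj C A \<in> D_le C L (n - 2)"
    using A shift_D_le_iff[OF ob(1), of 1 "n - 2"] shift_1[OF ob(1)] by simp
  then have "Sh_obj C A \<in> D_le C L n"
    by (rule D_le_mono[rotated]) simp
  then have B': "B \<in> D_le C L n"
    using D_le_extension[OF tri_rotate[OF tri]] assms by blast
  define B1 where "B1 = shift C (- 1) B"
  have B1: "B1 \<in> Obj C" "Sh_obj C B1 = B"
    using ob shift_Suc[of B "- 1"] shift_Obj by (auto simp: B1_def shift_0)
  have "B1 \<in> D_ge C R (n + 1)"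
    using B shift_D_ge_iff[OF ob(3), of "- 1" "n + 1"] by (simp add: B1_def)
  then have "B1 \<in> D_ge C R m"
    by (rule D_ge_antimono[rotated]) (use assms in simp)
  then have "A \<in> D_ge C R m"
    using D_ge_extension tri_rotate_back[of A X B1] tri B1 assms by blast
  then show thesis
    using that tri A B B' shift_core[of "- n"] by simp
qed


section \<open>The filtration of a bounded object\<close>

abbreviation core_filtration ::
  "'o \<Rightarrow> nat \<Rightarrow> (nat \<Rightarrow> 'o) \<Rightarrow> (nat \<Rightarrow> 'o) \<Rightarrow> (nat \<Rightarrow> int) \<Rightarrow> bool" where
  "core_filtration \<equiv> t_filtration C UNIV {(i, j). i \<le> j} (shift_sub C (core L R))"

lemma core_filtration_single:
  assumes "tri A X B" "zero_object C A" "B \<in> shift_sub C (core L R) k" "\<not> zero_object C B"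
  shows "core_filtration X 0 (case_nat X (\<lambda>_. A)) (\<lambda>_. B) (\<lambda>_. k)"
  using assms unfolding t_filtration_def tri_def by simp

lemma core_filtration_cons:
  assumes "tri A X B" "B \<in> shift_sub C (core L R) k" "\<not> zero_object C B"
    and fil: "core_filtration A n F Q \<phi>" and k: "\<And>i. i \<le> n \<Longrightarrow> k < \<phi> i"
  shows "core_filtration X (Suc n) (case_nat X F) (case_nat B Q) (case_nat k \<phi>)"
proof -
  have F: "F 0 = A" "zero_object C (F (Suc n))"
    and steps: "\<And>i. i \<le> n \<Longrightarrow> tri (F (Suc i)) (F i) (Q i)
      \<and> Q i \<in> shift_sub C (core L R) (\<phi> i) \<and> \<not> zero_object C (Q i)"
    and less: "\<And>i j. i < j \<Longrightarrow> j \<le> n \<Longrightarrow> \<phi> i < \<phi> j"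
    using fil by (simp_all add: t_filtration_def tri_def order.strict_iff_order)
  have "tri (case_nat X F (Suc i)) (case_nat X F i) (case_nat B Q i)
      \<and> case_nat B Q i \<in> shift_sub C (core L R) (case_nat k \<phi> i)
      \<and> \<not> zero_object C (case_nat B Q i)" if "i \<le> Suc n" for i
  proof (cases i)
    case 0
    then show ?thesis
      using assms(1-3) F(1) by simp
  next
    case (Suc j)
    then show ?thesis
      using steps[of j] that by simp
  qed
  moreover have "case_nat k \<phi> i < case_nat k \<phi> j" if ij: "i < j" "j \<le> Suc n" for i j
  proof -
    obtain j' where j: "j = Suc j'" "j' \<le> n"
      using ij by (cases j) auto
    show ?thesis
    proof (cases i)
      case 0
      then show ?thesis
        using j k by simp
    next
      case (Suc i')
      then show ?thesis
        using j ij less[of i' j'] by simp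
    qed
  qed
  ultimately show ?thesis
    using F(2) by (simp add: t_filtration_def tri_def order.strict_iff_order)
qed

text \<open>The lower bound \<open>- n\<close> on the indices is what makes the induction work: the filtration of
  \<open>A\<close> in \<open>D_le (n - 1)\<close> then has indices above \<open>- n\<close>, the index of the new quotient. A
  filtration has at least one quotient and all its quotients are nonzero, so the cases in
  which \<open>A\<close> or \<open>B\<close> vanishes are separate.\<close>

lemma core_filtration_exists:
  assumes "X \<in> D_ge C R m" "X \<in> D_le C L n" "\<not> zero_object C X"
  shows "\<exists>l F Q \<phi>. core_filtration X l F Q \<phi> \<and> (\<forall>i \<le> l. - n \<le> \<phi> i)"
  using assms
proof (induction "nat (n + 1 - m)" arbitrary: X n)
  case 0
  \<comment> \<open>Width 0 means \<open>n < m\<close>.\<close>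
  then have "orth X X"
    using orth_D_le_D_ge[of n m] by simp
  then show ?case
    using zero_object_if_orth_self 0 D_ge_Obj by blast
next
  case (Suc d)
  then have len: "d = nat (n - 1 + 1 - m)" and mn: "m \<le> n"
    by linarith+
  obtain A B where tri: "tri A X B" and A: "A \<in> D_ge C R m" "A \<in> D_le C L (n - 1)"
    and B: "B \<in> shift_sub C (core L R) (- n)"
    using top_cohomology_triangle[OF mn Suc.prems(1,2)] by blast
  consider "zero_object C B" | "\<not> zero_object C B" "zero_object C A"
    | "\<not> zero_object C B" "\<not> zero_object C A"
    by blast
  then show ?case
  proof cases
    case 1
    then have "isomorphic C A X"
      using isomorphic_if_zero_cone tri by blast
    then have "X \<in> D_le C L (n - 1)"
      using D_le_isomorphic A(2) tri_Obj(2)[OF tri] by blast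
    then obtain l F Q \<phi> where "core_filtration X l F Q \<phi>" "\<forall>i \<le> l. - (n - 1) \<le> \<phi> i"
      using Suc.hyps(1)[OF len] Suc.prems by blast
    moreover from this have "\<forall>i \<le> l. - n \<le> \<phi> i"
      by fastforce
    ultimately show ?thesis
      by blast
  next
    case 2
    then show ?thesis
      using core_filtration_single[OF tri _ B] by blast
  next
    case 3
    then obtain l F Q \<phi> where fil: "core_filtration A l F Q \<phi>" "\<forall>i \<le> l. - (n - 1) \<le> \<phi> i"
      using Suc.hyps(1)[OF len] A by blast
    then have "core_filtration X (Suc l) (case_nat X F) (case_nat B Q) (case_nat (- n) \<phi>)"
      using core_filtration_cons[OF tri B 3(1) fil(1)] by force
    moreover have "\<forall>i \<le> Suc l. - n \<le> case_nat (- n) \<phi> i"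
      using fil(2) by (force split: nat.split)
    ultimately show ?thesis
      by blast
  qed
qed

end

theorem lemma3p3:
  fixes C :: "('o, 'm, 'z) tri_cat_scheme" and L R :: "'o set"
  assumes "triangulated_cat C"
    and "bounded_t_structure C L R"
  shows "(\<forall>i. shift_sub C (core L R) i = D_le C L (- i) \<inter> D_ge C R (- i)) \<and>
    t_stability C (UNIV :: int set) {(i, j). i \<le> j} (\<lambda>i. shift_sub C (core L R) i)"
proof -
  interpret triangulated_cat C
    by fact
  interpret t_structured_cat C L R
    by unfold_locales (use assms(2) in \<open>simp add: bounded_t_structure_def\<close>)
  let ?P = "shift_sub C (core L R)"
  have linear: "linear_order_on (UNIV :: int set) {(i, j). i \<le> j}"
    by (auto simp: linear_order_on_def partial_order_on_def preorder_on_def refl_on_def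
        trans_def antisym_def total_on_def)
  have slices: "?P i \<noteq> {} \<and> strictly_full C (?P i) \<and> extension_closed C (?P i)" for i
  proof (intro conjI)
    show "?P i \<noteq> {}"
      using ex_zero_object zero_object_in_D_le zero_object_in_D_ge unfolding shift_core by blast
    show "strictly_full C (?P i)"
      using D_le_isomorphic D_ge_isomorphic D_le_Obj
      unfolding shift_core strictly_full_def by blast
    show "extension_closed C (?P i)"
      using D_le_extension D_ge_extension unfolding shift_core extension_closed_def tri_def by blast
  qed
  have translation: "\<exists>\<tau>. order_automorphism (UNIV :: int set) {(i, j). i \<le> j} \<tau> \<and>
      (\<forall>i \<in> UNIV. shift_sub C (?P i) 1 = ?P (\<tau> i) \<and> (i, \<tau> i) \<in> {(i, j). i \<le> j})"
  proof (intro exI conjI ballI)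
    show "order_automorphism (UNIV :: int set) {(i, j). i \<le> j} (\<lambda>i. i + 1)"
      unfolding order_automorphism_def by (auto intro: bij_betwI[where g = "\<lambda>i. i - 1"])
    show "shift_sub C (?P i) 1 = ?P (i + 1)" for i
      using L_Obj unfolding shift_sub_def image_image
      by (intro image_cong refl) (auto simp: core_def shift_shift add.commute)
  qed simp
  have vanishing: "Hom_deg_vanishes C k (?P j) (?P i)" if "i < j" "k \<le> 0" for i j k :: int
    unfolding Hom_deg_vanishes_def Hom_deg_def
  proof (intro ballI)
    fix X Y assume X: "X \<in> ?P j" and Y: "Y \<in> ?P i"
    have "shift C k Y \<in> D_ge C R (- i - k)"
      using Y shift_D_ge_iff[of Y k "- i - k"] D_ge_Obj unfolding shift_core by auto
    then have "orth X (shift C k Y)"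
      using X that by (intro orth_D_le_D_ge[of "- j" "- i - k"]) (auto simp: shift_core)
    then show "Hom C X (shift C k Y) = {Zero C X (shift C k Y)}"
      unfolding orth_def .
  qed
  have "\<exists>l F Q \<phi>. core_filtration X l F Q \<phi>" if "X \<in> Obj C" "\<not> zero_object C X" for X
    using assms(2) core_filtration_exists that unfolding bounded_t_structure_def by blast
  then show ?thesis
    unfolding t_stability_def
    using linear slices translation vanishing shift_core by (auto simp: less_le)
qed

end
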